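(* Let $G$ be any graph and let $v$ be any vertex of $G$. Then $\mathrm{str}(v)=0$ if and only if $v$ is a simplicial vertex.
   Context: Graphs are finite, undirected and simple. A $u$-$w$ geodesic in $G$ is a shortest path between $u$ and $w$ (a path and its reverse are the same geodesic). A geodesic passes through a vertex $v$ if $v$ is an internal vertex of it. The stress $\mathrm{str}(v)$ of a vertex $v$ is the number of geodesics in $G$ passing through $v$. $N(v)$ denotes the set of vertices adjacent to $v$. A vertex $v$ is simplicial if $N(v)$ induces a complete subgraph of $G$. *)

theory Defs
  imports "Graph_Theory.Graph_Theory"
begin

text \<open>
  A finite simple undirected graph is modelled by the locale \<^locale>\<open>graph\<close>, that is, as a finite
  symmetric digraph without loops and multiple arcs. It need not be connected.
\<close>

definition neighborhood :: "('a, 'b) pre_digraph \<Rightarrow> 'a \<Rightarrow> 'a set" where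
  "neighborhood G v = {u \<in> verts G. v \<rightarrow>\<^bsub>G\<^esub> u}"

definition geodesic :: "('a, 'b) pre_digraph \<Rightarrow> 'a \<Rightarrow> 'a vwalk \<Rightarrow> 'a \<Rightarrow> bool" where
  "geodesic G u p w \<longleftrightarrow>
     is_arg_min vwalk_length (\<lambda>q. vpath q G \<and> hd q = u \<and> last q = w) p"

definition internal_verts :: "'a vwalk \<Rightarrow> 'a set" where
  "internal_verts p = set (butlast (tl p))"

text \<open>
  Paths are vertex lists, so an undirected path corresponds to two lists, each the reverse of the
  other. To count it only once, a geodesic is represented by the set consisting of both lists.
  The endpoints range over all vertices; a geodesic with equal endpoints has no internal vertex.
\<close>

definition geodesics_through :: "('a, 'b) pre_digraph \<Rightarrow> 'a \<Rightarrow> 'a vwalk set set" where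
  "geodesics_through G v = {{p, rev p} | p. (\<exists>u w. geodesic G u p w) \<and> v \<in> internal_verts p}"

definition stress :: "('a, 'b) pre_digraph \<Rightarrow> 'a \<Rightarrow> nat" where
  "stress G v = card (geodesics_through G v)"

lemma (in graph) finite_geodesics_through: "finite (geodesics_through G v)"
proof (rule finite_subset)
  show "geodesics_through G v \<subseteq> (\<lambda>p. {p, rev p}) ` {p. vpath p G}"
    by (auto simp: geodesics_through_def geodesic_def is_arg_min_def)
  show "finite ((\<lambda>p. {p, rev p}) ` {p. vpath p G})"
    using vpaths_finite by (rule finite_imageI)
qed

text \<open>The empty graph counts as complete, so an isolated vertex is simplicial.\<close>

definition simplicial :: "('a, 'b) pre_digraph \<Rightarrow> 'a \<Rightarrow> bool" where
  "simplicial G v \<longleftrightarrow>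
     complete_digraph (card (neighborhood G v)) (G \<restriction> neighborhood G v)"

end

theory Submission
  imports Defs
begin

text \<open>
  The argument is local to \<open>v\<close>: only two-step paths \<open>a, v, b\<close> through \<open>v\<close> matter. Any geodesic through
  \<open>v\<close> enters \<open>v\<close> from a neighbour \<open>a\<close> and leaves to another neighbour \<open>b\<close>. The two are not adjacent,
  because the arc from \<open>a\<close> to \<open>b\<close> would be a shortcut bypassing \<open>v\<close>
  (\<open>geodesic_no_shortcut\<close>). Conversely, two distinct non-adjacent neighbours of \<open>v\<close> have distance
  exactly two, so \<open>a, v, b\<close> is itself a geodesic (\<open>geodesic_through_middle\<close>). Hence some geodesic
  passes through \<open>v\<close> iff \<open>v\<close> has two distinct non-adjacent neighbours, that is, iff \<open>v\<close> is not
  simplicial. Because there are only finitely many geodesics, their number is zero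
  only if there are none.
\<close>

context graph
begin

lemma graph_induce_subgraph:
  assumes "S \<subseteq> verts G"
  shows "graph (G \<restriction> S)"
proof -
  interpret H: wf_digraph "G \<restriction> S" by (rule wellformed_induce_subgraph)
  show ?thesis
  proof
    show "finite (verts (G \<restriction> S))" using assms finite_subset[OF _ finite_verts] by simp
    show "symmetric (G \<restriction> S)"
      by (rule induced_graph_imp_symmetric[OF sym_arcs induced_induce[OF assms]])
  qed (auto dest: no_loops no_multi_arcs)
qed

lemma simplicial_iff:
  "simplicial G v \<longleftrightarrow> (\<forall>a b. v \<rightarrow> a \<longrightarrow> v \<rightarrow> b \<longrightarrow> a \<noteq> b \<longrightarrow> a \<rightarrow> b)"
proof -
  let ?N = "neighborhood G v"
  have "graph (G \<restriction> ?N)"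
    by (rule graph_induce_subgraph) (auto simp: neighborhood_def)
  moreover have "arcs_ends (G \<restriction> ?N) = arcs_ends G \<inter> ?N \<times> ?N"
    by (auto simp: arcs_ends_conv)
  moreover have "a \<in> ?N \<longleftrightarrow> v \<rightarrow> a" for a
    by (auto simp: neighborhood_def adj_in_verts)
  ultimately show ?thesis
    using adj_not_same by (auto simp: simplicial_def complete_digraph_def)
qed

lemma stress_eq_0_iff:
  "stress G v = 0 \<longleftrightarrow> (\<nexists>u p w. geodesic G u p w \<and> v \<in> internal_verts p)"
  using finite_geodesics_through by (auto simp: stress_def geodesics_through_def)

text \<open>
  Deleting \<open>v\<close> from the list leaves a shorter path with the same endpoints as soon as \<open>a\<close> is adjacent
  to \<open>b\<close>; the endpoints survive because \<open>v\<close> lies strictly between \<open>a\<close> and \<open>b\<close>.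
\<close>

lemma geodesic_no_shortcut:
  assumes "geodesic G u (xs @ a # v # b # ys) w"
  shows "\<not> a \<rightarrow> b"
proof
  assume "a \<rightarrow> b"
  let ?q = "xs @ a # b # ys"
  have p: "vpath (xs @ a # v # b # ys) G" "hd (xs @ a # v # b # ys) = u"
      "last (xs @ a # v # b # ys) = w"
    and min: "\<And>q. vpath q G \<Longrightarrow> hd q = u \<Longrightarrow> last q = w \<Longrightarrow>
      vwalk_length (xs @ a # v # b # ys) \<le> vwalk_length q"
    using assms by (auto simp: geodesic_def is_arg_min_linorder)
  have arcs: "set (vwalk_arcs (xs @ a # c # zs)) =
      set (vwalk_arcs (xs @ [a])) \<union> {(a, c)} \<union> set (vwalk_arcs (c # zs))" for c zs
    using vwalk_arcs_append[of "xs @ [a]" "c # zs"] by simp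
  have "vpath ?q G"
    using p(1) \<open>a \<rightarrow> b\<close> by (auto simp: vpath_def vwalk_def arcs)
  moreover have "hd ?q = u" using p(2) by (cases xs) auto
  moreover have "last ?q = w" using p(3) by simp
  ultimately have "vwalk_length (xs @ a # v # b # ys) \<le> vwalk_length ?q" by (rule min)
  then show False by simp
qed

text \<open>
  A path of length zero would force \<open>a = b\<close>, and one of length one would make \<open>a\<close> adjacent to \<open>b\<close>,
  so no path from \<open>a\<close> to \<open>b\<close> is shorter than two.
\<close>

lemma geodesic_through_middle:
  assumes "a \<rightarrow> v" "v \<rightarrow> b" "a \<noteq> b" "\<not> a \<rightarrow> b"
  shows "geodesic G a [a, v, b] b"
proof -
  have "vpath [a, v, b] G"
    using assms adj_not_same by (auto simp: vpath_def vwalk_def adj_in_verts)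
  moreover have "2 \<le> vwalk_length q" if q: "vpath q G" "hd q = a" "last q = b" for q
  proof (rule ccontr)
    assume "\<not> 2 \<le> vwalk_length q"
    moreover have "q \<noteq> []" using q(1) by (auto simp: vpath_def vwalk_def)
    ultimately consider "q = [a]" | "q = [a, b]"
      using q(2,3) by (cases q; cases "tl q"; cases "tl (tl q)") auto
    then show False
      using assms(3,4) q by cases (auto simp: vpath_def vwalk_def)
  qed
  ultimately show ?thesis
    by (simp add: geodesic_def is_arg_min_linorder numeral_2_eq_2)
qed

lemma geodesic_through_iff:
  "(\<exists>u p w. geodesic G u p w \<and> v \<in> internal_verts p) \<longleftrightarrow>
    (\<exists>a b. v \<rightarrow> a \<and> v \<rightarrow> b \<and> a \<noteq> b \<and> \<not> a \<rightarrow> b)"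
proof
  assume "\<exists>u p w. geodesic G u p w \<and> v \<in> internal_verts p"
  then obtain u p w where geo: "geodesic G u p w" and v: "v \<in> set (butlast (tl p))"
    by (auto simp: internal_verts_def)
  \<comment> \<open>The endpoints \<open>c\<close> and \<open>d\<close> enclose \<open>v\<close>, so \<open>v\<close> has both a predecessor \<open>a\<close> and a successor \<open>b\<close> on \<open>p\<close>.\<close>
  obtain c r where "p = c # r" using v by (cases p) auto
  moreover from this v obtain d s where "r = s @ [d]" by (cases r rule: rev_cases) auto
  ultimately obtain ys zs where p_split: "p = (c # ys) @ v # (zs @ [d])"
    using v by (auto simp: in_set_conv_decomp)
  obtain xs a where "c # ys = xs @ [a]" by (cases "c # ys" rule: rev_cases) auto
  moreover obtain b ws where "zs @ [d] = b # ws" by (cases "zs @ [d]") auto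
  ultimately have p: "p = xs @ a # v # b # ws" using p_split by simp
  have "vwalk p G" "distinct p"
    using geo by (auto simp: geodesic_def is_arg_min_def vpath_def)
  moreover have "set (vwalk_arcs [a, v, b]) \<subseteq> set (vwalk_arcs p)"
    using set_vwalk_arcs_append2[of "a # v # b # ws" xs] by (auto simp: p)
  ultimately have "a \<rightarrow> v" "v \<rightarrow> b" "a \<noteq> b" by (auto simp: vwalk_def p)
  moreover have "v \<rightarrow> a" using arcs_ends_symmetric[OF sym_arcs \<open>a \<rightarrow> v\<close>] .
  moreover have "\<not> a \<rightarrow> b" using geodesic_no_shortcut geo p by blast
  ultimately show "\<exists>a b. v \<rightarrow> a \<and> v \<rightarrow> b \<and> a \<noteq> b \<and> \<not> a \<rightarrow> b" by blast
next
  assume "\<exists>a b. v \<rightarrow> a \<and> v \<rightarrow> b \<and> a \<noteq> b \<and> \<not> a \<rightarrow> b"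
  then obtain a b where "v \<rightarrow> a" "v \<rightarrow> b" "a \<noteq> b" "\<not> a \<rightarrow> b" by blast
  then have "geodesic G a [a, v, b] b"
    using geodesic_through_middle arcs_ends_symmetric[OF sym_arcs] by blast
  moreover have "v \<in> internal_verts [a, v, b]" by (simp add: internal_verts_def)
  ultimately show "\<exists>u p w. geodesic G u p w \<and> v \<in> internal_verts p" by blast
qed

end

theorem theorem2p4:
  fixes G :: "('a, 'b) pre_digraph" and v :: 'a
  assumes "graph G" and "v \<in> verts G"
  shows "stress G v = 0 \<longleftrightarrow> simplicial G v"
proof -
  interpret graph G by (rule assms(1))
  show ?thesis
    unfolding stress_eq_0_iff simplicial_iff geodesic_through_iff by blast
qed

end
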